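(* Assume that the feasible domain ratio (quantile) satisfies $\Gamma=1$. Then $\prod_{i=0}^{C}r_i^{\mathrm{rel}}(\boldsymbol{x}\mid\mathcal{D})$ is order isomorphic to $r_0(\boldsymbol{x}\mid\mathcal{D})$, i.e. for all $\boldsymbol{x},\boldsymbol{x}'\in\mathcal{X}$, $$\prod_{i=0}^{C}r_i^{\mathrm{rel}}(\boldsymbol{x}\mid\mathcal{D})\le\prod_{i=0}^{C}r_i^{\mathrm{rel}}(\boldsymbol{x}'\mid\mathcal{D})\iff r_0(\boldsymbol{x}\mid\mathcal{D})\le r_0(\boldsymbol{x}'\mid\mathcal{D}).$$
   Context: Setting (constrained tree-structured Parzen estimator, c-TPE): $\mathcal{X}\subseteq\mathbb{R}^D$ is a compact measurable search space and $\mu$ is the Lebesgue measure on $\mathcal{X}$. The objective $f:\mathcal{X}\to\mathbb{R}$ (to be minimized) and the constraints $c_1,\dots,c_C:\mathcal{X}\to\mathbb{R}$ are measurable and Lebesgue integrable, and $c_1^\star,\dots,c_C^\star\in\mathbb{R}$ are given constraint thresholds. For a set of observations $\mathcal{D}$, it is assumed that the supports, as functions of $\boldsymbol{x}$, of the probabilities of improvement $\mathbb{P}(f\le f^\star\mid\boldsymbol{x},\mathcal{D})=\int_{-\infty}^{f^\star}p(f\mid\boldsymbol{x},\mathcal{D})\,df$ and, analogously, $\mathbb{P}(c_i\le c_i^\star\mid\boldsymbol{x},\mathcal{D})$ under the predictive models cover all of $\mathcal{X}$ for arbitrary $f^\star,c_i^\star\in\mathbb{R}$. The feasible domain is $\mathcal{X}'=\{\boldsymbol{x}\in\mathcal{X}\mid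 c_i(\boldsymbol{x})\le c_i^\star\ \forall i\in\{1,\dots,C\}\}$, and the feasible domain ratio is $\Gamma:=\mu(\mathcal{X}')/\mu(\mathcal{X})\in(0,1]$. $\mathcal{D}=\{(\boldsymbol{x}_n,f_n,\boldsymbol{c}_n)\}_{n=1}^N$ is a set of observations, with $\boldsymbol{c}_n=[c_{1,n},\dots,c_{C,n}]$ the observed constraint values; an observation is feasible if $c_{i,n}\le c_i^\star$ for all $i$. $\mathcal{D}$ is split into $\mathcal{D}_0^{(l)}$ and $\mathcal{D}_0^{(g)}$ at an objective value $f^\star$: with observations sorted by objective value, $\mathcal{D}_0^{(l)}$ contains all observations up to the $\lceil\sqrt{N}/4\rceil$-th feasible one (whose objective value is $f^\star$), and $\mathcal{D}_0^{(g)}$ contains the rest. For each $i\in\{1,\dots,C\}$, $\mathcal{D}$ is split into $\mathcal{D}_i^{(l)}$, the observations with $c_{i,n}\le c_i'$, and $\mathcal{D}_i^{(g)}$, the rest, where $c_i'$ is the largest observed value of the $i$-th constraint that is at most $c_i^\star$, or $\min_n c_{i,n}$ if no observed value is at most $c_i^\star$. For $i\in\{0,\dots,C\}$, $p(\boldsymbol{x}\mid\mathcal{D}_i^{(l)})$ and $p(\boldsymbol{x}\mid\mathcal{D}_i^{(g)})$ are kernel density estimators built on the two parts, $r_i(\boldsymbol{x}\mid\mathcal{D}):=p(\boldsymbol{x}\mid\mathcal{D}_i^{(l)})/p(\boldsymbol{x}\mid\mathcal{D}_i^{(g)})$ is the density ratio, $\hat\gamma_i:=|\mathcal{D}_i^{(l)}|/|\mathcal{D}|$,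 and the relative density ratio is $$r_i^{\mathrm{rel}}(\boldsymbol{x}\mid\mathcal{D}):=\bigl(\hat\gamma_i+(1-\hat\gamma_i)\,r_i(\boldsymbol{x}\mid\mathcal{D})^{-1}\bigr)^{-1},$$ which is identically $1$ when $\hat\gamma_i=1$.
   Formalization: Added: observations are noise-free, their locations avoid some Lebesgue-null set depending only on the search space, objective, constraints and thresholds (otherwise an infeasible observation can break the claim), and N ≥ 2 (for N = 1 the density ratio r_0 is undefined). *)

theory Defs
  imports "HOL-Analysis.Analysis"
begin

text \<open>
  The constraints are \<open>c 1, \<dots>, c C\<close> with thresholds \<open>cs 1, \<dots>, cs C\<close>;
  the index \<open>0\<close> is reserved for the objective.
\<close>

definition feasible_domain ::
    "'a set \<Rightarrow> nat \<Rightarrow> (nat \<Rightarrow> 'a \<Rightarrow> real) \<Rightarrow> (nat \<Rightarrow> real) \<Rightarrow> 'a set" where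
  "feasible_domain X C c cs = {x \<in> X. \<forall>i\<in>{1..C}. c i x \<le> cs i}"

definition feasible_ratio ::
    "'a::euclidean_space set \<Rightarrow> nat \<Rightarrow> (nat \<Rightarrow> 'a \<Rightarrow> real) \<Rightarrow> (nat \<Rightarrow> real) \<Rightarrow> real" where
  "feasible_ratio X C c cs = measure lebesgue (feasible_domain X C c cs) / measure lebesgue X"

datatype 'a obs = Obs (loc: 'a) (obj: real) (con: "nat \<Rightarrow> real")

text \<open>
  A data set is a list of observations. Its order only matters for breaking ties when
  sorting by objective value.
\<close>

definition observations ::
    "'a set \<Rightarrow> nat \<Rightarrow> ('a \<Rightarrow> real) \<Rightarrow> (nat \<Rightarrow> 'a \<Rightarrow> real) \<Rightarrow> 'a obs list \<Rightarrow> bool" where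
  "observations S C f c D \<longleftrightarrow>
     (\<forall>d\<in>set D. loc d \<in> S \<and> obj d = f (loc d) \<and> (\<forall>i\<in>{1..C}. con d i = c i (loc d)))"

definition feasible :: "nat \<Rightarrow> (nat \<Rightarrow> real) \<Rightarrow> 'a obs \<Rightarrow> bool" where
  "feasible C cs d \<longleftrightarrow> (\<forall>i\<in>{1..C}. con d i \<le> cs i)"

text \<open>
  \<open>upto_kth P k ds\<close> is the prefix of \<open>ds\<close> ending at the \<open>k\<close>-th element that satisfies \<open>P\<close>,
  and all of \<open>ds\<close> if there are fewer than \<open>k\<close> such elements.
\<close>

fun upto_kth :: "('b \<Rightarrow> bool) \<Rightarrow> nat \<Rightarrow> 'b list \<Rightarrow> 'b list" where
  "upto_kth P 0 ds = []"
| "upto_kth P (Suc k) [] = []"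
| "upto_kth P (Suc k) (d # ds) = d # upto_kth P (if P d then k else Suc k) ds"

definition obj_lower :: "nat \<Rightarrow> (nat \<Rightarrow> real) \<Rightarrow> 'a obs list \<Rightarrow> 'a obs list" where
  "obj_lower C cs D =
     upto_kth (feasible C cs) (nat \<lceil>sqrt (real (length D)) / 4\<rceil>) (sort_key obj D)"

definition obj_upper :: "nat \<Rightarrow> (nat \<Rightarrow> real) \<Rightarrow> 'a obs list \<Rightarrow> 'a obs list" where
  "obj_upper C cs D = drop (length (obj_lower C cs D)) (sort_key obj D)"

definition split_value :: "(nat \<Rightarrow> real) \<Rightarrow> 'a obs list \<Rightarrow> nat \<Rightarrow> real" where
  "split_value cs D i =
     (let V = (\<lambda>d. con d i) ` set D
      in if \<exists>v\<in>V. v \<le> cs i then Max {v \<in> V. v \<le> cs i} else Min V)"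

definition lower_part :: "nat \<Rightarrow> (nat \<Rightarrow> real) \<Rightarrow> 'a obs list \<Rightarrow> nat \<Rightarrow> 'a obs list" where
  "lower_part C cs D i =
     (if i = 0 then obj_lower C cs D else filter (\<lambda>d. con d i \<le> split_value cs D i) D)"

definition upper_part :: "nat \<Rightarrow> (nat \<Rightarrow> real) \<Rightarrow> 'a obs list \<Rightarrow> nat \<Rightarrow> 'a obs list" where
  "upper_part C cs D i =
     (if i = 0 then obj_upper C cs D else filter (\<lambda>d. \<not> con d i \<le> split_value cs D i) D)"

definition lower_quantile :: "nat \<Rightarrow> (nat \<Rightarrow> real) \<Rightarrow> 'a obs list \<Rightarrow> nat \<Rightarrow> real" where
  "lower_quantile C cs D i = real (length (lower_part C cs D i)) / real (length D)"

text \<open>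
  \<open>k h y\<close> is the kernel with bandwidth \<open>h\<close> centred at \<open>y\<close>. The bandwidth may be of any type
  (a scalar, a vector, a matrix). Kernels truncated to the search space are covered, as densities
  vanishing outside it.
\<close>

definition kernel_on :: "'a::euclidean_space set \<Rightarrow> ('h \<Rightarrow> 'a \<Rightarrow> 'a \<Rightarrow> real) \<Rightarrow> bool" where
  "kernel_on X k \<longleftrightarrow>
     (\<forall>h. \<forall>y\<in>X. (\<forall>x. 0 \<le> k h y x) \<and> has_bochner_integral lborel (k h y) 1)"

definition kde ::
    "('h \<Rightarrow> 'a \<Rightarrow> 'a \<Rightarrow> real) \<Rightarrow> ('a obs list \<Rightarrow> 'h) \<Rightarrow> 'a obs list \<Rightarrow> 'a \<Rightarrow> real" where
  "kde k bw E x = (\<Sum>d\<leftarrow>E. k (bw E) (loc d) x) / real (length E)"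

text \<open>
  Density ratios take values in \<open>[0, \<infinity>]\<close>, so that a vanishing denominator gives \<open>\<infinity>\<close>
  and the inverse of a vanishing ratio is \<open>\<infinity>\<close>. Since \<open>0 * \<infinity> = 0\<close> in \<^typ>\<open>ennreal\<close>, the
  relative ratio is \<open>1\<close> whenever \<open>lower_quantile C cs D i = 1\<close>.
\<close>

definition density_ratio ::
    "('h \<Rightarrow> 'a \<Rightarrow> 'a \<Rightarrow> real) \<Rightarrow> ('a obs list \<Rightarrow> 'h) \<Rightarrow> nat \<Rightarrow> (nat \<Rightarrow> real) \<Rightarrow>
     'a obs list \<Rightarrow> nat \<Rightarrow> 'a \<Rightarrow> ennreal" where
  "density_ratio k bw C cs D i x =
     ennreal (kde k bw (lower_part C cs D i) x) / ennreal (kde k bw (upper_part C cs D i) x)"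

definition rel_density_ratio ::
    "('h \<Rightarrow> 'a \<Rightarrow> 'a \<Rightarrow> real) \<Rightarrow> ('a obs list \<Rightarrow> 'h) \<Rightarrow> nat \<Rightarrow> (nat \<Rightarrow> real) \<Rightarrow>
     'a obs list \<Rightarrow> nat \<Rightarrow> 'a \<Rightarrow> ennreal" where
  "rel_density_ratio k bw C cs D i x =
     inverse (ennreal (lower_quantile C cs D i)
              + ennreal (1 - lower_quantile C cs D i) * inverse (density_ratio k bw C cs D i x))"

text \<open>
  \<open>q x\<close> is the predictive density of a scalar quantity at \<open>x\<close>, given the observations.
\<close>

definition predictive_model :: "'a set \<Rightarrow> ('a \<Rightarrow> real \<Rightarrow> real) \<Rightarrow> bool" where
  "predictive_model X q \<longleftrightarrow>
     (\<forall>x\<in>X. (\<forall>v. 0 \<le> q x v) \<and> has_bochner_integral lborel (q x) 1)"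

definition prob_improvement :: "('a \<Rightarrow> real \<Rightarrow> real) \<Rightarrow> real \<Rightarrow> 'a \<Rightarrow> real" where
  "prob_improvement q t x = (LINT v:{..t}|lborel. q x v)"

definition full_support :: "'a set \<Rightarrow> ('a \<Rightarrow> real \<Rightarrow> real) \<Rightarrow> bool" where
  "full_support X q \<longleftrightarrow> (\<forall>t. X \<subseteq> {x. prob_improvement q t x \<noteq> 0})"

end

theory Submission
  imports Defs
begin

text \<open>
  If \<open>\<Gamma> = 1\<close>, almost every point is feasible. A data set avoiding the null set of
  infeasible points lies entirely below each constraint split, so all relative ratios with
  \<open>i \<ge> 1\<close> are identically \<open>1\<close>. Its objective split has \<open>0 < \<gamma>\<^sub>0 < 1\<close>, and then
  \<open>r \<mapsto> (\<gamma>\<^sub>0 + (1 - \<gamma>\<^sub>0) r\<^sup>-\<^sup>1)\<^sup>-\<^sup>1\<close> is strictly increasing on \<open>[0, \<infinity>]\<close>.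
\<close>

text \<open>The feasible domain and X have equal finite Lebesgue measure, so subtracting measures
  leaves 0 for their difference. Measurability of the constraints makes the feasible domain
  measurable.\<close>

lemma infeasible_null_set:
  fixes X :: "'a::euclidean_space set"
  assumes X: "X \<in> lmeasurable"
    and c: "\<And>i. i \<in> {1..C} \<Longrightarrow> c i \<in> borel_measurable (lebesgue_on X)"
    and ratio: "feasible_ratio X C c cs = 1"
  shows "X - feasible_domain X C c cs \<in> null_sets (lebesgue_on X)"
proof -
  let ?F = "feasible_domain X C c cs"
  have [measurable]: "X \<in> sets lebesgue"
    using X by (rule fmeasurableD)
  have "{x \<in> space (lebesgue_on X). \<forall>i\<in>{1..C}. c i x \<le> cs i} \<in> sets (lebesgue_on X)"
    using c by (intro sets.sets_Collect_finite_All borel_measurable_le) auto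
  then have F_on: "?F \<in> sets (lebesgue_on X)"
    by (simp add: feasible_domain_def)
  then have F: "?F \<in> sets lebesgue" "?F \<subseteq> X"
    by (auto simp: sets_restrict_space_iff feasible_domain_def)
  \<comment> \<open>As division by 0 yields 0, a ratio of 1 also rules out
    \<open>measure lebesgue X = 0\<close>.\<close>
  have eq: "measure lebesgue ?F = measure lebesgue X"
    using ratio by (auto simp: feasible_ratio_def divide_eq_1_iff)
  have F_fin: "?F \<in> lmeasurable"
    using X F by (blast intro: fmeasurableI2)
  then have "measure lebesgue (X - ?F) = 0"
    using eq X F by (simp add: measurable_measure_Diff)
  then have "X - ?F \<in> null_sets lebesgue"
    using fmeasurable.Diff[OF X F_fin]
    by (auto simp: negligible_iff_measure simp flip: negligible_iff_null_sets)
  then show ?thesis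
    by (simp add: null_sets_restrict_space)
qed

lemma length_upto_kth:
  "(\<forall>d\<in>set ds. P d) \<Longrightarrow> length (upto_kth P k ds) = min k (length ds)"
  by (induction P k ds rule: upto_kth.induct) auto

text \<open>When no observed value exceeds the threshold, \<open>split_value\<close> is the largest
  observed value, so nothing is filtered out.\<close>

lemma lower_part_constraint_eq:
  assumes "i \<noteq> 0" and "\<forall>d\<in>set D. con d i \<le> cs i"
  shows "lower_part C cs D i = D"
proof -
  let ?V = "(\<lambda>d. con d i) ` set D"
  have "con d i \<le> split_value cs D i" if "d \<in> set D" for d
  proof -
    have "{v \<in> ?V. v \<le> cs i} = ?V" "\<exists>v\<in>?V. v \<le> cs i"
      using assms(2) that by auto
    then show ?thesis
      using that by (simp add: split_value_def)
  qed
  then show ?thesis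
    using assms(1) by (simp add: lower_part_def filter_id_conv)
qed

text \<open>The quantile is 1, so the weight of the inverse ratio is 0 and removes that term even
  where it is infinite. Nonemptiness of \<open>D\<close> excludes the quantile 0 / 0 = 0.\<close>

lemma rel_density_ratio_eq_1:
  assumes "i \<noteq> 0" and "\<forall>d\<in>set D. con d i \<le> cs i" and "D \<noteq> []"
  shows "rel_density_ratio k bw C cs D i x = 1"
  using assms by (simp add: rel_density_ratio_def lower_quantile_def lower_part_constraint_eq)

lemma lower_quantile_0_bounds:
  assumes "\<forall>d\<in>set D. feasible C cs d" and "2 \<le> length D"
  shows "0 < lower_quantile C cs D 0" and "lower_quantile C cs D 0 < 1"
proof -
  let ?n = "length D"
  let ?m = "nat \<lceil>sqrt (real ?n) / 4\<rceil>"
  have len: "length (lower_part C cs D 0) = min ?m ?n"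
    using assms(1) by (simp add: lower_part_def obj_lower_def length_upto_kth)
  have "sqrt (real ?n) \<le> real ?n"
    using assms(2) by (intro real_le_lsqrt) (auto simp: power2_eq_square mult_le_cancel_left1)
  \<comment> \<open>Rounding up adds less than 1, so m < n/4 + 1, which is below n once n is at
    least 2. For n = 1 one has m = n.\<close>
  then have "real ?m < real ?n"
    using assms(2) by linarith
  moreover have "0 < ?m"
    using assms(2) by (auto simp flip: length_greater_0_conv)
  ultimately show "0 < lower_quantile C cs D 0" "lower_quantile C cs D 0 < 1"
    using assms(2) by (simp_all add: lower_quantile_def len)
qed

lemma inverse_ennreal_le_iff: "inverse (a::ennreal) \<le> inverse b \<longleftrightarrow> b \<le> a"
  unfolding less_eq_ennreal.rep_eq inverse_ennreal.rep_eq
  by (metis enn2ereal_nonneg ereal_inverse_antimono ereal_inverse_antimono_strict not_le)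

text \<open>The two inversions each reverse the order and so cancel. In between, adding a finite
  constant and multiplying by a factor that is neither 0 nor \<open>top\<close> both preserve and
  reflect the order.\<close>

lemma ennreal_relative_ratio_le_iff:
  fixes r s :: ennreal
  assumes "0 < a" and "a < 1"
  shows "inverse (ennreal a + ennreal (1 - a) * inverse r)
      \<le> inverse (ennreal a + ennreal (1 - a) * inverse s) \<longleftrightarrow> r \<le> s"
proof -
  have "ennreal (1 - a) \<noteq> 0" "ennreal (1 - a) \<noteq> top"
    using assms by auto
  then show ?thesis
    by (simp add: inverse_ennreal_le_iff ennreal_mult_le_mult_iff ennreal_add_left_cancel_le)
qed

text \<open>A ratio of 1 gives feasibility only almost everywhere, so observations must avoid a null
  set, while x and x' range over all of X. With a single feasible observation the objective quantile
  would be 1 and its relative ratio constant, hence the bound on \<open>length D\<close>.\<close>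

theorem corollary2:
  fixes X :: "(real ^ 'd) set"
    and f :: "real ^ 'd \<Rightarrow> real"
    and C :: nat
    and c :: "nat \<Rightarrow> real ^ 'd \<Rightarrow> real"
    and cs :: "nat \<Rightarrow> real"
  assumes "compact X"
    and "integrable (lebesgue_on X) f"
    and "\<And>i. i \<in> {1..C} \<Longrightarrow> integrable (lebesgue_on X) (c i)"
    and "feasible_ratio X C c cs = 1"
  shows "\<exists>Z\<in>null_sets (lebesgue_on X).
    \<forall>(D :: (real ^ 'd) obs list)
      (q :: nat \<Rightarrow> real ^ 'd \<Rightarrow> real \<Rightarrow> real)
      (k :: 'h \<Rightarrow> real ^ 'd \<Rightarrow> real ^ 'd \<Rightarrow> real)
      (bw :: (real ^ 'd) obs list \<Rightarrow> 'h).
      observations (X - Z) C f c D \<longrightarrow>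
      2 \<le> length D \<longrightarrow>
      (\<forall>i\<in>{0..C}. predictive_model X (q i) \<and> full_support X (q i)) \<longrightarrow>
      kernel_on X k \<longrightarrow>
      (\<forall>x\<in>X. \<forall>x'\<in>X.
        (\<Prod>i=0..C. rel_density_ratio k bw C cs D i x)
          \<le> (\<Prod>i=0..C. rel_density_ratio k bw C cs D i x')
        \<longleftrightarrow> density_ratio k bw C cs D 0 x \<le> density_ratio k bw C cs D 0 x')"
proof
  let ?F = "feasible_domain X C c cs"
  \<comment> \<open>The witness is the infeasible region; it is fixed by X and the constraints alone
    and so serves all data sets, kernels and bandwidths at once.\<close>
  show "X - ?F \<in> null_sets (lebesgue_on X)"
    using assms by (intro infeasible_null_set lmeasurable_compact borel_measurable_integrable)
  show "\<forall>(D :: (real ^ 'd) obs list)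
      (q :: nat \<Rightarrow> real ^ 'd \<Rightarrow> real \<Rightarrow> real)
      (k :: 'h \<Rightarrow> real ^ 'd \<Rightarrow> real ^ 'd \<Rightarrow> real)
      (bw :: (real ^ 'd) obs list \<Rightarrow> 'h).
      observations (X - (X - ?F)) C f c D \<longrightarrow>
      2 \<le> length D \<longrightarrow>
      (\<forall>i\<in>{0..C}. predictive_model X (q i) \<and> full_support X (q i)) \<longrightarrow>
      kernel_on X k \<longrightarrow>
      (\<forall>x\<in>X. \<forall>x'\<in>X.
        (\<Prod>i=0..C. rel_density_ratio k bw C cs D i x)
          \<le> (\<Prod>i=0..C. rel_density_ratio k bw C cs D i x')
        \<longleftrightarrow> density_ratio k bw C cs D 0 x \<le> density_ratio k bw C cs D 0 x')"
  proof (intro allI impI ballI)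
    fix D :: "(real ^ 'd) obs list" and k :: "'h \<Rightarrow> real ^ 'd \<Rightarrow> real ^ 'd \<Rightarrow> real"
      and bw :: "(real ^ 'd) obs list \<Rightarrow> 'h" and x x'
    assume obs: "observations (X - (X - ?F)) C f c D" and len: "2 \<le> length D"
    have con_le: "con d i \<le> cs i" if "d \<in> set D" "i \<in> {1..C}" for d i
      using obs that by (auto simp: observations_def feasible_domain_def)
    then have bounds: "0 < lower_quantile C cs D 0" "lower_quantile C cs D 0 < 1"
      using len by (auto intro!: lower_quantile_0_bounds simp: feasible_def)
    have prod: "(\<Prod>i=0..C. rel_density_ratio k bw C cs D i y) = rel_density_ratio k bw C cs D 0 y"
      for y
    proof -
      have "rel_density_ratio k bw C cs D i y = 1" if "i \<in> {1..C}" for i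
        using that len con_le by (intro rel_density_ratio_eq_1) auto
      then have "(\<Prod>i=1..C. rel_density_ratio k bw C cs D i y) = 1"
        by (intro prod.neutral) simp
      then show ?thesis
        by (simp add: prod.atLeast_Suc_atMost)
    qed
    show "(\<Prod>i=0..C. rel_density_ratio k bw C cs D i x)
        \<le> (\<Prod>i=0..C. rel_density_ratio k bw C cs D i x')
      \<longleftrightarrow> density_ratio k bw C cs D 0 x \<le> density_ratio k bw C cs D 0 x'"
      unfolding prod unfolding rel_density_ratio_def using bounds by (rule ennreal_relative_ratio_le_iff)
  qed
qed

end
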